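(* Let $T$ be a rooted, countably infinite and locally finite tree and let $S$ be the forward shift. Then $S$ maps $\mathcal{L}_0$ into $\mathcal{L}_0$, $S:\mathcal{L}_0\to\mathcal{L}_0$ is bounded, and $\|S\|\le 1$. If $T$ is leafless, then $\|Sf\|=\|f\|$ for every $f\in\mathcal{L}_0$.
   Context: A tree is an undirected graph (no loops or multiple edges) in which any two vertices are joined by exactly one path; $T$ also denotes its vertex set. It is locally finite if every vertex has finite degree. $T$ has a distinguished vertex $o$, the root; $|v|$ is the length (number of edges) of the path from $o$ to $v$. For $v\neq o$, the parent $\mathrm{par}(v)$ is the vertex preceding $v$ on the unique path from $o$ to $v$; the vertices with parent $v$ are the children of $v$. A leaf is a vertex with no children; $T$ is leafless if it has no leaves. For $f:T\to\mathbb{C}$ define $f':T\to\mathbb{C}$ by $f'(o)=f(o)$ and $f'(v)=f(v)-f(\mathrm{par}(v))$ for $v\neq o$. The Lipschitz space $\mathcal{L}$ is the Banach space of all $f:T\to\mathbb{C}$ with $f'$ bounded, with norm $\|f\|=\sup_{v\in T}|f'(v)|$. The little Lipschitz space $\mathcal{L}_0$ is the closed subspace of all $f$ with $\lim_{|v|\to\infty}f'(v)=0$, with the same norm. The forward shift is defined on functions $f:T\to\mathbb{C}$ by $(Sf)(o)=0$ and $(Sf)(v)=f(\mathrm{par}(v))$ for $v\ne o$. *)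

theory Defs
  imports "HOL-Analysis.Analysis"
begin

text \<open>A graph is given by its adjacency relation; its vertex set is the whole type \<open>'v\<close>.
  Throughout, \<open>r\<close> is the root.\<close>

definition simple_path :: "('v \<Rightarrow> 'v \<Rightarrow> bool) \<Rightarrow> 'v \<Rightarrow> 'v list \<Rightarrow> 'v \<Rightarrow> bool" where
  "simple_path adj u p w \<longleftrightarrow>
     p \<noteq> [] \<and> hd p = u \<and> last p = w \<and> distinct p \<and> successively adj p"

definition is_tree :: "('v \<Rightarrow> 'v \<Rightarrow> bool) \<Rightarrow> bool" where
  "is_tree adj \<longleftrightarrow> symp adj \<and> irreflp adj \<and> (\<forall>u w. \<exists>!p. simple_path adj u p w)"

definition locally_finite :: "('v \<Rightarrow> 'v \<Rightarrow> bool) \<Rightarrow> bool" where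
  "locally_finite adj \<longleftrightarrow> (\<forall>v. finite {w. adj v w})"

definition path_to :: "('v \<Rightarrow> 'v \<Rightarrow> bool) \<Rightarrow> 'v \<Rightarrow> 'v \<Rightarrow> 'v list" where
  "path_to adj r v = (THE p. simple_path adj r p v)"

text \<open>Paths are lists of vertices, hence the number of edges is the list length minus one.\<close>

definition depth :: "('v \<Rightarrow> 'v \<Rightarrow> bool) \<Rightarrow> 'v \<Rightarrow> 'v \<Rightarrow> nat" where
  "depth adj r v = length (path_to adj r v) - 1"

text \<open>The value of \<open>parent\<close> at the root is unspecified and never used.\<close>

definition parent :: "('v \<Rightarrow> 'v \<Rightarrow> bool) \<Rightarrow> 'v \<Rightarrow> 'v \<Rightarrow> 'v" where
  "parent adj r v = last (butlast (path_to adj r v))"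

definition children :: "('v \<Rightarrow> 'v \<Rightarrow> bool) \<Rightarrow> 'v \<Rightarrow> 'v \<Rightarrow> 'v set" where
  "children adj r v = {w. w \<noteq> r \<and> parent adj r w = v}"

definition leafless :: "('v \<Rightarrow> 'v \<Rightarrow> bool) \<Rightarrow> 'v \<Rightarrow> bool" where
  "leafless adj r \<longleftrightarrow> (\<forall>v. children adj r v \<noteq> {})"

definition tree_deriv ::
    "('v \<Rightarrow> 'v \<Rightarrow> bool) \<Rightarrow> 'v \<Rightarrow> ('v \<Rightarrow> complex) \<Rightarrow> 'v \<Rightarrow> complex" where
  "tree_deriv adj r f v = (if v = r then f r else f v - f (parent adj r v))"

definition lip_space :: "('v \<Rightarrow> 'v \<Rightarrow> bool) \<Rightarrow> 'v \<Rightarrow> ('v \<Rightarrow> complex) set" where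
  "lip_space adj r = {f. bounded (range (tree_deriv adj r f))}"

definition lip_norm :: "('v \<Rightarrow> 'v \<Rightarrow> bool) \<Rightarrow> 'v \<Rightarrow> ('v \<Rightarrow> complex) \<Rightarrow> real" where
  "lip_norm adj r f = (SUP v. norm (tree_deriv adj r f v))"

text \<open>The filter \<open>filtercomap (depth adj r) at_top\<close> expresses that \<open>depth adj r v\<close>
  tends to infinity.\<close>

definition little_lip_space :: "('v \<Rightarrow> 'v \<Rightarrow> bool) \<Rightarrow> 'v \<Rightarrow> ('v \<Rightarrow> complex) set" where
  "little_lip_space adj r =
     {f \<in> lip_space adj r.
        (tree_deriv adj r f \<longlongrightarrow> 0) (filtercomap (depth adj r) at_top)}"

definition forward_shift ::
    "('v \<Rightarrow> 'v \<Rightarrow> bool) \<Rightarrow> 'v \<Rightarrow> ('v \<Rightarrow> complex) \<Rightarrow> ('v \<Rightarrow> complex)" where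
  "forward_shift adj r f = (\<lambda>v. if v = r then 0 else f (parent adj r v))"

text \<open>The spaces depend on the tree and hence are sets of functions rather than types, so
  bounded linear operators on such a space \<open>X\<close> with norm \<open>N\<close>, and their operator norms,
  are defined relative to \<open>X\<close> and \<open>N\<close>.\<close>

definition bounded_operator_on ::
    "('v \<Rightarrow> complex) set \<Rightarrow> (('v \<Rightarrow> complex) \<Rightarrow> real)
      \<Rightarrow> (('v \<Rightarrow> complex) \<Rightarrow> ('v \<Rightarrow> complex)) \<Rightarrow> bool" where
  "bounded_operator_on X N A \<longleftrightarrow>
     A ` X \<subseteq> X \<and>
     (\<forall>f\<in>X. \<forall>g\<in>X. A (\<lambda>v. f v + g v) = (\<lambda>v. A f v + A g v)) \<and>
     (\<forall>c. \<forall>f\<in>X. A (\<lambda>v. c * f v) = (\<lambda>v. c * A f v)) \<and>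
     (\<exists>C. \<forall>f\<in>X. N (A f) \<le> C * N f)"

definition operator_norm_on ::
    "('v \<Rightarrow> complex) set \<Rightarrow> (('v \<Rightarrow> complex) \<Rightarrow> real)
      \<Rightarrow> (('v \<Rightarrow> complex) \<Rightarrow> ('v \<Rightarrow> complex)) \<Rightarrow> real" where
  "operator_norm_on X N A = (SUP f\<in>{f \<in> X. N f \<le> 1}. N (A f))"

end

theory Submission
  imports Defs
begin

text \<open>
  Everything rests on the identity \<open>(S f)' = S (f')\<close>: the increment of \<open>S f\<close> along the edge
  into \<open>v \<noteq> r\<close> is the value of \<open>f'\<close> at the parent of \<open>v\<close>. Here the convention \<open>f' r = f r\<close> at the
  root is what makes the children of the root fit the same formula. So the values of \<open>(S f)'\<close>
  are 0 and the values of \<open>f'\<close> at vertices that have a child. The norm can therefore only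
  decrease, and it is preserved when every vertex has a child. Passing to the parent lowers
  the depth by one, so \<open>f' v \<longrightarrow> 0\<close> as the depth of \<open>v\<close> grows forces the same for \<open>S (f')\<close>.
\<close>

text \<open>Dropping the last vertex of the path from the root to \<open>v\<close> leaves a simple path to the
  parent of \<open>v\<close>, and in a tree there is no other.\<close>

lemma depth_eq_Suc_depth_parent:
  assumes tree: "is_tree adj" and "v \<noteq> r"
  shows "depth adj r v = Suc (depth adj r (parent adj r v))"
proof -
  have unique: "\<exists>!p. simple_path adj r p w" for w
    using tree by (simp add: is_tree_def)
  define p where "p = path_to adj r v"
  define q where "q = butlast p"
  have p: "simple_path adj r p v"
    unfolding p_def path_to_def by (rule theI'[OF unique])
  then have pq: "p = q @ [v]"
    unfolding q_def simple_path_def by (metis append_butlast_last_id)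
  with p \<open>v \<noteq> r\<close> have "q \<noteq> []"
    by (auto simp: simple_path_def)
  with p pq have "simple_path adj r q (last q)"
    by (auto simp: simple_path_def successively_append_iff)
  moreover have "parent adj r v = last q"
    by (simp add: parent_def p_def q_def)
  ultimately have "path_to adj r (parent adj r v) = q"
    unfolding path_to_def by (metis the1_equality[OF unique])
  with pq \<open>q \<noteq> []\<close> show ?thesis
    by (simp add: depth_def p_def[symmetric])
qed

lemma tree_deriv_forward_shift:
  "tree_deriv adj r (forward_shift adj r f) = forward_shift adj r (tree_deriv adj r f)"
  by (auto simp: tree_deriv_def forward_shift_def)

lemma bdd_above_norm_tree_deriv:
  assumes "f \<in> lip_space adj r"
  shows "bdd_above (range (\<lambda>v. norm (tree_deriv adj r f v)))"
  using assms by (auto simp: lip_space_def bounded_iff bdd_above_def)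

lemma norm_tree_deriv_le_lip_norm:
  assumes "f \<in> lip_space adj r"
  shows "norm (tree_deriv adj r f v) \<le> lip_norm adj r f"
  unfolding lip_norm_def by (rule cSUP_upper[OF UNIV_I bdd_above_norm_tree_deriv[OF assms]])

lemma norm_tree_deriv_forward_shift_le:
  assumes "f \<in> lip_space adj r"
  shows "norm (tree_deriv adj r (forward_shift adj r f) v) \<le> lip_norm adj r f"
proof -
  have "0 \<le> lip_norm adj r f"
    using norm_ge_zero norm_tree_deriv_le_lip_norm[OF assms] by (rule order_trans)
  then show ?thesis
    using norm_tree_deriv_le_lip_norm[OF assms]
    unfolding tree_deriv_forward_shift by (simp add: forward_shift_def)
qed

lemma forward_shift_in_lip_space:
  assumes "f \<in> lip_space adj r"
  shows "forward_shift adj r f \<in> lip_space adj r"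
  using norm_tree_deriv_forward_shift_le[OF assms] by (auto simp: lip_space_def bounded_iff)

lemma lip_norm_forward_shift_le:
  assumes "f \<in> lip_space adj r"
  shows "lip_norm adj r (forward_shift adj r f) \<le> lip_norm adj r f"
  unfolding lip_norm_def[of adj r "forward_shift adj r f"]
  by (rule cSUP_least) (simp_all add: norm_tree_deriv_forward_shift_le[OF assms])

text \<open>Each value \<open>f' v\<close> survives as the value of \<open>(S f)'\<close> at any child of \<open>v\<close>.\<close>

lemma lip_norm_forward_shift_leafless:
  assumes "leafless adj r" and "f \<in> lip_space adj r"
  shows "lip_norm adj r (forward_shift adj r f) = lip_norm adj r f"
proof (rule antisym[OF lip_norm_forward_shift_le[OF assms(2)]])
  have "norm (tree_deriv adj r f v) \<le> lip_norm adj r (forward_shift adj r f)" for v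
  proof -
    obtain w where "w \<noteq> r" "parent adj r w = v"
      using assms(1) unfolding leafless_def children_def by blast
    then have "tree_deriv adj r f v = tree_deriv adj r (forward_shift adj r f) w"
      unfolding tree_deriv_forward_shift by (simp add: forward_shift_def)
    then show ?thesis
      using norm_tree_deriv_le_lip_norm[OF forward_shift_in_lip_space[OF assms(2)]] by simp
  qed
  then show "lip_norm adj r f \<le> lip_norm adj r (forward_shift adj r f)"
    unfolding lip_norm_def[of adj r f] by (intro cSUP_least) simp_all
qed

lemma tendsto_zero_forward_shift:
  assumes "is_tree adj" and g: "(g \<longlongrightarrow> 0) (filtercomap (depth adj r) at_top)"
  shows "(forward_shift adj r g \<longlongrightarrow> 0) (filtercomap (depth adj r) at_top)"
proof (rule tendstoI)
  fix e :: real
  assume "e > 0"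
  then obtain N where N: "\<And>v. depth adj r v \<ge> N \<Longrightarrow> dist (g v) 0 < e"
    using tendstoD[OF g] by (auto simp: eventually_filtercomap_at_top_linorder)
  have "dist (forward_shift adj r g v) 0 < e" if "depth adj r v \<ge> Suc N" for v
    using that N[of "parent adj r v"] depth_eq_Suc_depth_parent[OF assms(1), of v r] \<open>e > 0\<close>
    by (cases "v = r") (simp_all add: forward_shift_def)
  then show "\<forall>\<^sub>F v in filtercomap (depth adj r) at_top. dist (forward_shift adj r g v) 0 < e"
    by (auto simp: eventually_filtercomap_at_top_linorder)
qed

lemma forward_shift_in_little_lip_space:
  assumes "is_tree adj" and "f \<in> little_lip_space adj r"
  shows "forward_shift adj r f \<in> little_lip_space adj r"
  using assms
  by (simp add: little_lip_space_def forward_shift_in_lip_space tree_deriv_forward_shift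
      tendsto_zero_forward_shift)

text \<open>A supremum over an empty set of reals is unspecified, so the bound on the operator norm
  below needs an element of the unit ball.\<close>

lemma zero_in_little_lip_unit_ball:
  "(\<lambda>_. 0) \<in> {f \<in> little_lip_space adj r. lip_norm adj r f \<le> 1}"
proof -
  have "tree_deriv adj r (\<lambda>_. 0) = (\<lambda>_. 0)"
    by (auto simp: tree_deriv_def)
  then show ?thesis
    by (simp add: little_lip_space_def lip_space_def lip_norm_def)
qed

theorem theorem3p4:
  fixes adj :: "'v \<Rightarrow> 'v \<Rightarrow> bool" and r :: 'v
  assumes "is_tree adj"
    and "infinite (UNIV :: 'v set)" and "countable (UNIV :: 'v set)"
    and "locally_finite adj"
  shows "forward_shift adj r ` little_lip_space adj r \<subseteq> little_lip_space adj r
    \<and> bounded_operator_on (little_lip_space adj r) (lip_norm adj r) (forward_shift adj r)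
    \<and> operator_norm_on (little_lip_space adj r) (lip_norm adj r) (forward_shift adj r) \<le> 1
    \<and> (leafless adj r \<longrightarrow>
         (\<forall>f \<in> little_lip_space adj r.
            lip_norm adj r (forward_shift adj r f) = lip_norm adj r f))"
proof (intro conjI impI ballI)
  let ?X = "little_lip_space adj r" and ?N = "lip_norm adj r" and ?S = "forward_shift adj r"
  have contraction: "?N (?S f) \<le> ?N f" if "f \<in> ?X" for f
    using that by (simp add: little_lip_space_def lip_norm_forward_shift_le)
  show maps: "?S ` ?X \<subseteq> ?X"
    using forward_shift_in_little_lip_space[OF assms(1)] by blast
  show "bounded_operator_on ?X ?N ?S"
    unfolding bounded_operator_on_def
  proof (intro conjI ballI allI maps)
    show "?S (\<lambda>v. f v + g v) = (\<lambda>v. ?S f v + ?S g v)" for f g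
      by (auto simp: forward_shift_def)
    show "?S (\<lambda>v. c * f v) = (\<lambda>v. c * ?S f v)" for c f
      by (auto simp: forward_shift_def)
    show "\<exists>C. \<forall>f\<in>?X. ?N (?S f) \<le> C * ?N f"
      using contraction by (intro exI[of _ 1]) simp
  qed
  show "operator_norm_on ?X ?N ?S \<le> 1"
    unfolding operator_norm_on_def
  proof (rule cSUP_least)
    show "{f \<in> ?X. ?N f \<le> 1} \<noteq> {}"
      by (rule ex_in_conv[THEN iffD1, OF exI, OF zero_in_little_lip_unit_ball])
    show "?N (?S f) \<le> 1" if "f \<in> {f \<in> ?X. ?N f \<le> 1}" for f
      using that contraction[of f] by simp
  qed
  show "?N (?S f) = ?N f" if "leafless adj r" and "f \<in> ?X" for f
    using that by (simp add: little_lip_space_def lip_norm_forward_shift_leafless)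
qed

end
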